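(* Let $f\in\mathcal C^1(\mathbb R^n)$ be globally bounded below, with $\|\nabla f(x)-\nabla f(y)\|\le L\|x-y\|$ for all $x,y\in\mathbb R^n$ and some $L>0$. Let $f$ be convex with bounded level sets, so that $\|x-x^*\|\le D$ for all $x$ with $f(x)\le f(x^0)$, where $x^*$ is a global minimizer of $f$, and let $f^*=f(x^* )$. Let the sequence of random models and corresponding directions generated in the line-search algorithm described in the context be $(p)$-probabilistically sufficiently accurate, with constant $\kappa>0$ and with $p>1/2$. Then the expected number of iterations $N_\epsilon$ that the algorithm takes until $f(X^k)-f^*\le\epsilon$ occurs is bounded by $$\mathbb E(N_\epsilon)\le\frac{2p}{(2p-1)^2}\left[\frac{M}{\epsilon}+\log_\gamma\left(\frac{1-\theta}{\alpha_0(0.5L+\kappa)}\right)\right],$$ where $M=\frac{(1+\kappa\alpha_{\max})^2D^2(0.5L+\kappa)}{\theta(1-\theta)}$ is a constant independent of $p$ and $\epsilon$.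
   Context: Line-search algorithm with random models. Constants $\gamma\in(0,1)$, $\theta\in(0,1)$, $\alpha_{\max}>0$; initial $x^0\in\mathbb R^n$ and $0<\alpha_0<\alpha_{\max}$. At iteration $k=0,1,\dots$: compute a random model $m_k$ (the linear model $m_k(x)=f(x^k)+(x-x^k)^Tg^k$) and use it to generate a direction $g^k$; check the sufficient decrease condition $f(x^k-\alpha_kg^k)\le f(x^k)-\alpha_k\theta\|g^k\|^2$. If it holds (successful iteration), set $x^{k+1}=x^k-\alpha_kg^k$ and $\alpha_{k+1}=\min\{\alpha_{\max},\gamma^{-1}\alpha_k\}$. Otherwise (unsuccessful), set $x^{k+1}=x^k$ and $\alpha_{k+1}=\gamma\alpha_k$. Capital letters $M_k,G^k,X^k,\mathcal A_k$ denote the random variables whose realizations are $m_k,g^k,x^k,\alpha_k$. The sequence is $(p)$-probabilistically sufficiently accurate if there is a constant $\kappa>0$ such that the indicators $I_k=\mathbb 1\{\|G^k-\nabla f(X^k)\|\le\kappa\mathcal A_k\|G^k\|\}$ satisfy $P(I_k=1\mid\mathcal F^M_{k-1})\ge p$, where $\mathcal F^M_{k-1}=\sigma(M_0,\dots,M_{k-1})$. In the underlying general analysis it is assumed, without loss of generality, that the threshold $C=\frac{1-\theta}{0.5L+\kappa}$ (below which every true iteration, i.e. one with $I_k=1$, is successful) has the form $C=\gamma^c\alpha_0<\gamma\alpha_{\max}$ for some positive integer $c$.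
   Formalization: The formal theorem additionally assumes that the maximal step size lies on the grid of step sizes, i.e. α_0 = γ^j α_max for some natural number j; without this the stated bound can fail. *)

theory Defs
  imports "HOL-Probability.Probability"
begin

definition sufficient_decrease ::
  "('a::real_inner \<Rightarrow> real) \<Rightarrow> real \<Rightarrow> 'a \<Rightarrow> real \<Rightarrow> 'a \<Rightarrow> bool"
  where "sufficient_decrease f \<theta> x \<alpha> g \<longleftrightarrow>
    f (x - \<alpha> *\<^sub>R g) \<le> f x - \<alpha> * \<theta> * (norm g)\<^sup>2"

text \<open>One realization of the algorithm: \<open>x\<close>, \<open>\<alpha>\<close> and \<open>g\<close> are the sequences of iterates,
  step sizes and directions.\<close>

definition line_search_run ::
  "('a::real_inner \<Rightarrow> real) \<Rightarrow> real \<Rightarrow> real \<Rightarrow> real \<Rightarrow> 'a \<Rightarrow> real \<Rightarrow>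
   (nat \<Rightarrow> 'a) \<Rightarrow> (nat \<Rightarrow> real) \<Rightarrow> (nat \<Rightarrow> 'a) \<Rightarrow> bool"
  where "line_search_run f \<theta> \<gamma> \<alpha>max x0 \<alpha>0 x \<alpha> g \<longleftrightarrow>
    x 0 = x0 \<and> \<alpha> 0 = \<alpha>0 \<and>
    (\<forall>k. if sufficient_decrease f \<theta> (x k) (\<alpha> k) (g k)
         then x (Suc k) = x k - \<alpha> k *\<^sub>R g k \<and> \<alpha> (Suc k) = min \<alpha>max (inverse \<gamma> * \<alpha> k)
         else x (Suc k) = x k \<and> \<alpha> (Suc k) = \<gamma> * \<alpha> k)"

definition linear_model :: "('a::real_inner \<Rightarrow> real) \<Rightarrow> 'a \<Rightarrow> 'a \<Rightarrow> 'a \<Rightarrow> real"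
  where "linear_model f xk g = (\<lambda>x. f xk + (x - xk) \<bullet> g)"

text \<open>The \<open>\<sigma>\<close>-algebra generated by the random functions \<open>M 0, \<dots>, M (k - 1)\<close>, i.e. by all their
  point evaluations; for \<open>k = 0\<close> it is trivial.  The index is shifted by one with respect to
  the notation \<open>F\<^sub>k\<^sub>-\<^sub>1\<close>, which avoids the index \<open>-1\<close>.\<close>

definition past_models :: "'w measure \<Rightarrow> (nat \<Rightarrow> 'w \<Rightarrow> 'a \<Rightarrow> real) \<Rightarrow> nat \<Rightarrow> 'w measure"
  where "past_models P M k =
    sigma (space P) {(\<lambda>\<omega>. M i \<omega> x) -` B \<inter> space P |i x B. i < k \<and> B \<in> sets borel}"

definition accurate_event ::
  "'w measure \<Rightarrow> ('a::real_normed_vector \<Rightarrow> 'a) \<Rightarrow> real \<Rightarrow> (nat \<Rightarrow> 'w \<Rightarrow> 'a) \<Rightarrow> (nat \<Rightarrow> 'w \<Rightarrow> real) \<Rightarrow>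
   (nat \<Rightarrow> 'w \<Rightarrow> 'a) \<Rightarrow> nat \<Rightarrow> 'w set"
  where "accurate_event P grad \<kappa> X A G k =
    {\<omega> \<in> space P. norm (G k \<omega> - grad (X k \<omega>)) \<le> \<kappa> * A k \<omega> * norm (G k \<omega>)}"

definition prob_sufficiently_accurate ::
  "'w measure \<Rightarrow> ('a::real_inner \<Rightarrow> real) \<Rightarrow> ('a \<Rightarrow> 'a) \<Rightarrow> real \<Rightarrow> real \<Rightarrow>
   (nat \<Rightarrow> 'w \<Rightarrow> 'a) \<Rightarrow> (nat \<Rightarrow> 'w \<Rightarrow> real) \<Rightarrow> (nat \<Rightarrow> 'w \<Rightarrow> 'a) \<Rightarrow> bool"
  where "prob_sufficiently_accurate P f grad p \<kappa> X A G \<longleftrightarrow>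
    (\<forall>k. AE \<omega> in P.
       p \<le> real_cond_exp P
              (past_models P (\<lambda>i \<omega>. linear_model f (X i \<omega>) (G i \<omega>)) k)
              (indicator (accurate_event P grad \<kappa> X A G k)) \<omega>)"

text \<open>The first \<open>k\<close> with \<open>f (x k) - fmin \<le> \<epsilon>\<close>; it is \<open>\<infinity>\<close> if there is none.\<close>

definition iterations_until ::
  "('a \<Rightarrow> real) \<Rightarrow> real \<Rightarrow> real \<Rightarrow> (nat \<Rightarrow> 'a) \<Rightarrow> enat"
  where "iterations_until f fmin \<epsilon> x = (INF k\<in>{k. f (x k) - fmin \<le> \<epsilon>}. enat k)"

end

theory Submission
  imports Defs
begin

text \<open>Let \<open>C = (1 - \<theta>) / (0.5 * L + \<kappa>)\<close>.  Accurate iterations with step size at most \<open>C\<close> succeed, and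
  all step sizes have the form \<open>C * \<gamma> powi (- y)\<close> with integral \<open>y\<close>, starting from \<open>y = c\<close>.  Call an
  accurate successful iteration with step size at least \<open>C\<close> rewarding; it raises the reciprocal of
  the optimality gap by at least \<open>1 / M\<close>, so at most \<open>M / \<epsilon>\<close> of the iterations before the last
  one are rewarding.  Since \<open>\<bar>y\<bar>\<close> minus twice the number of rewarding iterations drops by at least
  one in every accurate iteration and grows by at most one otherwise, the accurate iterations
  outnumber the others by at most \<open>c + 2 * (M / \<epsilon>) + 1\<close> on every path.  In expectation this
  excess is at least \<open>(2 * p - 1) * E(N)\<close>, and since \<open>c \<ge> 1\<close> and \<open>p / (2 * p - 1) \<ge> 1\<close>, the bound on
  \<open>E(N)\<close> follows.\<close>

subsection \<open>Convex functions with Lipschitz gradient\<close>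

lemma GDERIV_DERIV_line:
  assumes "\<And>x. GDERIV f x :> grad x"
  shows "((\<lambda>t. f (x + t *\<^sub>R d)) has_real_derivative (grad (x + t *\<^sub>R d) \<bullet> d)) (at t)"
proof -
  have f: "(f has_derivative (\<lambda>h. h \<bullet> grad (x + t *\<^sub>R d))) (at (x + t *\<^sub>R d))"
    using assms unfolding gderiv_def .
  have "((\<lambda>t. x + t *\<^sub>R d) has_derivative (\<lambda>h. h *\<^sub>R d)) (at t)"
    by (auto intro!: derivative_eq_intros)
  from has_derivative_compose[OF this f] show ?thesis
    by (simp add: has_field_derivative_def inner_commute mult_commute_abs)
qed

lemma GDERIV_imp_continuous_on:
  assumes "\<And>x. GDERIV f x :> grad x"
  shows "continuous_on A f"
  using assms unfolding gderiv_def
  by (meson continuous_at_imp_continuous_on has_derivative_continuous)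

text \<open>Along the line through \<open>x\<close> and \<open>y\<close> this is the one-variable
  tangent inequality, taken at 0 and evaluated at 1.\<close>

lemma convex_above_gradient:
  fixes f :: "'a::real_inner \<Rightarrow> real"
  assumes grad: "\<And>x. GDERIV f x :> grad x" and convex: "convex_on UNIV f"
  shows "f x + grad x \<bullet> (y - x) \<le> f y"
proof -
  define \<phi> where "\<phi> t = f (x + t *\<^sub>R (y - x))" for t :: real
  have "convex_on UNIV \<phi>"
  proof (rule convex_onI)
    fix t u v :: real
    assume t: "0 < t" "t < 1"
    have "x + ((1 - t) *\<^sub>R u + t *\<^sub>R v) *\<^sub>R (y - x)
      = (1 - t) *\<^sub>R (x + u *\<^sub>R (y - x)) + t *\<^sub>R (x + v *\<^sub>R (y - x))"
      by (simp add: algebra_simps)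
    then show "\<phi> ((1 - t) *\<^sub>R u + t *\<^sub>R v) \<le> (1 - t) * \<phi> u + t * \<phi> v"
      unfolding \<phi>_def using convex_onD[OF convex, of t] t by simp
  qed simp
  moreover have "(\<phi> has_real_derivative (grad x \<bullet> (y - x))) (at 0)"
    unfolding \<phi>_def using GDERIV_DERIV_line[OF grad, of x "y - x" 0] by simp
  ultimately have "\<phi> 1 - \<phi> 0 \<ge> grad x \<bullet> (y - x) * (1 - 0)"
    by (intro convex_on_imp_above_tangent[where A = UNIV]) auto
  then show ?thesis
    by (simp add: \<phi>_def)
qed

lemma Lipschitz_gradient_descent:
  fixes f :: "'a::real_inner \<Rightarrow> real"
  assumes grad: "\<And>x. GDERIV f x :> grad x"
    and Lipschitz: "\<And>x y. norm (grad x - grad y) \<le> L * norm (x - y)"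
  shows "f (x + d) \<le> f x + grad x \<bullet> d + L / 2 * (norm d)\<^sup>2"
proof -
  define \<psi> where "\<psi> t = f (x + t *\<^sub>R d) - (t * (grad x \<bullet> d) + L / 2 * t\<^sup>2 * (norm d)\<^sup>2)" for t
  have "\<psi> 1 \<le> \<psi> 0"
  proof (rule DERIV_nonpos_imp_nonincreasing[of 0 1 \<psi>])
    fix t :: real
    assume t: "0 \<le> t" "t \<le> 1"
    have "(\<psi> has_real_derivative
        (grad (x + t *\<^sub>R d) \<bullet> d - (grad x \<bullet> d + L * t * (norm d)\<^sup>2))) (at t)"
      unfolding \<psi>_def by (rule derivative_eq_intros GDERIV_DERIV_line[OF grad] refl | simp)+
    moreover have "grad (x + t *\<^sub>R d) \<bullet> d - grad x \<bullet> d \<le> L * t * (norm d)\<^sup>2"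
    proof -
      have "(grad (x + t *\<^sub>R d) - grad x) \<bullet> d \<le> norm (grad (x + t *\<^sub>R d) - grad x) * norm d"
        by (rule norm_cauchy_schwarz)
      also have "\<dots> \<le> L * norm (x + t *\<^sub>R d - x) * norm d"
        by (intro mult_right_mono Lipschitz) simp
      finally show ?thesis
        using t by (simp add: inner_diff_left power2_eq_square)
    qed
    then have "grad (x + t *\<^sub>R d) \<bullet> d - (grad x \<bullet> d + L * t * (norm d)\<^sup>2) \<le> 0"
      by simp
    ultimately show "\<exists>y. (\<psi> has_real_derivative y) (at t) \<and> y \<le> 0"
      by blast
  qed simp
  then show ?thesis
    by (simp add: \<psi>_def)
qed

subsection \<open>A single run\<close>

text \<open>Accuracy makes the slope along \<open>g\<close> at least
  \<open>(1 - \<kappa> * \<alpha>) * (norm g)\<^sup>2\<close>, and curvature costs at most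
  \<open>L / 2 * \<alpha>\<^sup>2 * (norm g)\<^sup>2\<close>. The two losses add up to the factor
  \<open>(0.5 * L + \<kappa>) * \<alpha>\<close>, which is where the threshold \<open>C\<close>
  comes from.\<close>

lemma accurate_small_step_sufficient_decrease:
  fixes f :: "'a::real_inner \<Rightarrow> real"
  assumes grad: "\<And>x. GDERIV f x :> grad x"
    and Lipschitz: "\<And>x y. norm (grad x - grad y) \<le> L * norm (x - y)"
    and accurate: "norm (g - grad x) \<le> \<kappa> * \<alpha> * norm g"
    and \<alpha>: "0 < \<alpha>" "(0.5 * L + \<kappa>) * \<alpha> \<le> 1 - \<theta>"
  shows "sufficient_decrease f \<theta> x \<alpha> g"
proof -
  have "(g - grad x) \<bullet> g \<le> norm (g - grad x) * norm g"
    by (rule norm_cauchy_schwarz)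
  also have "\<dots> \<le> \<kappa> * \<alpha> * norm g * norm g"
    by (intro mult_right_mono accurate) simp
  finally have inner: "(norm g)\<^sup>2 - \<kappa> * \<alpha> * (norm g)\<^sup>2 \<le> grad x \<bullet> g"
    by (simp add: inner_diff_left power2_eq_square flip: power2_norm_eq_inner)
  have "f (x - \<alpha> *\<^sub>R g) \<le> f x - \<alpha> * (grad x \<bullet> g) + L / 2 * (\<alpha>\<^sup>2 * (norm g)\<^sup>2)"
    using Lipschitz_gradient_descent[OF grad Lipschitz, of x "- \<alpha> *\<^sub>R g"]
    by (simp add: power_mult_distrib)
  also have "\<dots> \<le> f x - \<alpha> * ((norm g)\<^sup>2 - \<kappa> * \<alpha> * (norm g)\<^sup>2) + L / 2 * (\<alpha>\<^sup>2 * (norm g)\<^sup>2)"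
    using inner \<alpha> by (simp add: mult_left_mono)
  also have "\<dots> = f x - \<alpha> * (norm g)\<^sup>2 * (1 - (0.5 * L + \<kappa>) * \<alpha>)"
    by (simp add: algebra_simps power2_eq_square)
  also have "\<dots> \<le> f x - \<alpha> * (norm g)\<^sup>2 * \<theta>"
    using \<alpha> by (intro diff_left_mono mult_left_mono) auto
  finally show ?thesis
    by (simp add: sufficient_decrease_def mult_ac)
qed

text \<open>Convexity bounds the gap by \<open>D\<close> times the gradient norm, accuracy bounds
  the gradient by a multiple of \<open>g\<close>, and a step of length at least \<open>C\<close>
  gains \<open>\<theta> * C * (norm g)\<^sup>2\<close>. The gain is thus quadratic in the gap, as a
  constant rise of the reciprocal gap requires. The product form also covers
  \<open>D = 0\<close>.\<close>

lemma accurate_large_step_gap_decrease: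
  fixes f :: "'a::real_inner \<Rightarrow> real"
  assumes grad: "\<And>x. GDERIV f x :> grad x" and convex: "convex_on UNIV f"
    and accurate: "norm (g - grad x) \<le> \<kappa> * \<alpha> * norm g"
    and decrease: "sufficient_decrease f \<theta> x \<alpha> g"
    and minimizer: "f z \<le> f x"
    and D: "norm (x - z) \<le> D"
    and pos: "0 < \<theta>" "0 \<le> \<kappa>" "0 < C" "C \<le> \<alpha>" "\<alpha> \<le> \<alpha>max"
  shows "\<theta> * C * (f x - f z)\<^sup>2 \<le> (1 + \<kappa> * \<alpha>max)\<^sup>2 * D\<^sup>2 * (f x - f (x - \<alpha> *\<^sub>R g))"
proof -
  have "norm (grad x) \<le> norm g + norm (g - grad x)"
    by (metis add.commute norm_triangle_sub norm_minus_commute)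
  also have "\<dots> \<le> norm g + \<kappa> * \<alpha>max * norm g"
    using accurate pos by (smt (verit) mult_left_mono mult_right_mono norm_ge_zero)
  finally have grad_le: "norm (grad x) \<le> (1 + \<kappa> * \<alpha>max) * norm g"
    by (simp add: algebra_simps)
  have "f x - f z \<le> grad x \<bullet> (x - z)"
    using convex_above_gradient[OF grad convex, of x z] by (simp add: inner_diff_right)
  also have "\<dots> \<le> norm (grad x) * norm (x - z)"
    by (rule norm_cauchy_schwarz)
  also have "\<dots> \<le> ((1 + \<kappa> * \<alpha>max) * norm g) * D"
    using grad_le D pos by (intro mult_mono) auto
  finally have "(f x - f z)\<^sup>2 \<le> (((1 + \<kappa> * \<alpha>max) * norm g) * D)\<^sup>2"
    using minimizer by (intro power_mono) auto
  then have "\<theta> * C * (f x - f z)\<^sup>2 \<le> \<theta> * C * (((1 + \<kappa> * \<alpha>max) * norm g) * D)\<^sup>2"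
    using pos by (intro mult_left_mono) auto
  also have "\<dots> = (1 + \<kappa> * \<alpha>max)\<^sup>2 * D\<^sup>2 * (C * \<theta> * (norm g)\<^sup>2)"
    by (simp add: power_mult_distrib mult_ac)
  also have "\<dots> \<le> (1 + \<kappa> * \<alpha>max)\<^sup>2 * D\<^sup>2 * (\<alpha> * \<theta> * (norm g)\<^sup>2)"
    using pos by (intro mult_left_mono mult_right_mono) auto
  also have "\<dots> \<le> (1 + \<kappa> * \<alpha>max)\<^sup>2 * D\<^sup>2 * (f x - f (x - \<alpha> *\<^sub>R g))"
    using decrease unfolding sufficient_decrease_def by (intro mult_left_mono) auto
  finally show ?thesis .
qed

text \<open>Induction on a potential, with exponent 0 standing for the threshold \<open>C\<close>.
  An accurate step at \<open>y < 0\<close> succeeds and moves towards 0, and an accurate failure can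
  only occur at \<open>y > 0\<close> and also moves towards 0. An accurate success at
  \<open>y \<ge> 0\<close> raises the left side by at most 2, which its reward pays for. An
  inaccurate step moves \<open>y\<close> by at most one, offset by the summand -1.\<close>

lemma step_size_walk_bound:
  fixes \<alpha> :: "nat \<Rightarrow> real" and S T :: "nat \<Rightarrow> bool" and c m :: int
  assumes b: "1 < b" and C: "0 < C"
    and start: "\<alpha> 0 = C * b powi c" "0 \<le> c" "c \<le> m" "1 \<le> m"
    and success: "\<And>k. S k \<Longrightarrow> \<alpha> (Suc k) = min (C * b powi m) (b * \<alpha> k)"
    and failure: "\<And>k. \<not> S k \<Longrightarrow> \<alpha> (Suc k) = inverse b * \<alpha> k"
    and small: "\<And>k. T k \<Longrightarrow> \<alpha> k \<le> C \<Longrightarrow> S k"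
  shows "\<exists>y. \<alpha> n = C * b powi y \<and> y \<le> m \<and>
    \<bar>y\<bar> + (\<Sum>k<n. if T k then 1 else - 1)
      \<le> c + 2 * (\<Sum>k<n. of_bool (T k \<and> S k \<and> C \<le> \<alpha> k))"
proof (induction n)
  case 0
  then show ?case using start by auto
next
  case (Suc n)
  then obtain y where y: "\<alpha> n = C * b powi y" "y \<le> m"
    and IH: "\<bar>y\<bar> + (\<Sum>k<n. if T k then 1 else - 1)
      \<le> c + 2 * (\<Sum>k<n. of_bool (T k \<and> S k \<and> C \<le> \<alpha> k))"
    by blast
  have powi_le_iff: "b powi i \<le> b powi j \<longleftrightarrow> i \<le> j" for i j
    using b power_int_strict_increasing[of j i b] power_int_increasing[of i j b]
    by (meson linorder_not_le order_less_imp_le)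
  have le_C: "\<alpha> n \<le> C \<longleftrightarrow> y \<le> 0" and ge_C: "C \<le> \<alpha> n \<longleftrightarrow> 0 \<le> y"
    using C powi_le_iff[of y 0] powi_le_iff[of 0 y] by (simp_all add: y)
  show ?case
  proof (cases "S n")
    case True
    have "b * \<alpha> n = C * b powi (y + 1)"
      using b by (simp add: y power_int_add)
    \<comment> \<open>The cap is the grid point with exponent \<open>m\<close>, so truncating the
      step size truncates the exponent and the walk stays integral.\<close>
    then have "\<alpha> (Suc n) = C * b powi (min m (y + 1))"
      using success[OF True] C by (simp add: min_def powi_le_iff)
    then show ?thesis
      using True IH y(2) start ge_C by (intro exI[of _ "min m (y + 1)"]) auto
  next
    case False
    have "\<alpha> (Suc n) = C * b powi (y - 1)"
      using failure[OF False] b by (simp add: y power_int_diff field_simps)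
    then show ?thesis
      using False IH y(2) le_C small[of n] by (intro exI[of _ "y - 1"]) auto
  qed
qed

text \<open>The deterministic part of the argument, for one fixed realization. By
  \<open>cap\<close>, the maximal step size lies on the geometric grid through
  \<open>\<alpha>0\<close> and \<open>C\<close>.\<close>

locale line_search_path =
  fixes f :: "'a::real_inner \<Rightarrow> real" and grad :: "'a \<Rightarrow> 'a"
    and x0 xmin :: 'a and L D \<gamma> \<theta> \<alpha>max \<alpha>0 \<kappa> C :: real and c j :: nat
    and x g :: "nat \<Rightarrow> 'a" and \<alpha> :: "nat \<Rightarrow> real"
  assumes gradient: "\<And>x. GDERIV f x :> grad x"
    and L: "0 < L"
    and Lipschitz: "\<And>x y. norm (grad x - grad y) \<le> L * norm (x - y)"
    and convex: "convex_on UNIV f"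
    and minimizer: "\<And>x. f xmin \<le> f x"
    and D: "\<And>x. f x \<le> f x0 \<Longrightarrow> norm (x - xmin) \<le> D"
    and \<gamma>: "0 < \<gamma>" "\<gamma> < 1"
    and \<theta>: "0 < \<theta>" "\<theta> < 1"
    and \<kappa>: "0 < \<kappa>"
    and C: "C = (1 - \<theta>) / (0.5 * L + \<kappa>)"
    and threshold: "0 < c" "C = \<gamma> ^ c * \<alpha>0"
    and cap: "\<gamma> ^ j * \<alpha>max = \<alpha>0"
    and run: "line_search_run f \<theta> \<gamma> \<alpha>max x0 \<alpha>0 x \<alpha> g"
begin

definition accurate :: "nat \<Rightarrow> bool" where
  "accurate k \<longleftrightarrow> norm (g k - grad (x k)) \<le> \<kappa> * \<alpha> k * norm (g k)"

definition successful :: "nat \<Rightarrow> bool" where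
  "successful k \<longleftrightarrow> sufficient_decrease f \<theta> (x k) (\<alpha> k) (g k)"

definition rewarding :: "nat \<Rightarrow> bool" where
  "rewarding k \<longleftrightarrow> accurate k \<and> successful k \<and> C \<le> \<alpha> k"

text \<open>Inserting the value of \<open>C\<close> turns this into the constant of the
  theorem.\<close>

definition M :: real where
  "M = (1 + \<kappa> * \<alpha>max)\<^sup>2 * D\<^sup>2 / (\<theta> * C)"

lemma init: "x 0 = x0" "\<alpha> 0 = \<alpha>0"
  and success: "successful k \<Longrightarrow> x (Suc k) = x k - \<alpha> k *\<^sub>R g k"
    "successful k \<Longrightarrow> \<alpha> (Suc k) = min \<alpha>max (inverse \<gamma> * \<alpha> k)"
  and failure: "\<not> successful k \<Longrightarrow> x (Suc k) = x k" "\<not> successful k \<Longrightarrow> \<alpha> (Suc k) = \<gamma> * \<alpha> k"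
  using run unfolding line_search_run_def successful_def by (auto split: if_splits)

lemma C_pos: "0 < C"
  using C \<theta> L \<kappa> by simp

lemma \<alpha>0_le: "0 < \<alpha>0" "\<alpha>0 \<le> \<alpha>max"
proof -
  show \<alpha>0: "0 < \<alpha>0"
    using C_pos threshold \<gamma> by (simp add: zero_less_mult_iff)
  have "\<gamma> ^ j * \<alpha>max \<le> 1 * \<alpha>max"
    using \<alpha>0 cap \<gamma> by (intro mult_right_mono power_le_one)
      (auto simp: zero_less_mult_iff dest: order.strict_implies_order)
  then show "\<alpha>0 \<le> \<alpha>max" using cap by simp
qed

lemma \<alpha>_bounds: "0 < \<alpha> k \<and> \<alpha> k \<le> \<alpha>max"
proof (induction k)
  case 0
  then show ?case using init \<alpha>0_le by simp
next
  case (Suc k)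
  have "\<gamma> * \<alpha> k \<le> 1 * \<alpha>max"
    using Suc \<gamma> by (intro mult_mono) auto
  then show ?case
    using Suc \<gamma> \<alpha>0_le by (cases "successful k") (auto simp: success failure)
qed

lemma f_decreasing: "f (x (Suc k)) \<le> f (x k)"
proof (cases "successful k")
  case True
  moreover have "0 \<le> \<alpha> k * \<theta> * (norm (g k))\<^sup>2"
    using \<alpha>_bounds[of k] \<theta> by simp
  ultimately show ?thesis
    unfolding success(1)[OF True] by (simp add: successful_def sufficient_decrease_def)
qed (simp add: failure)

lemma f_le_start: "f (x k) \<le> f x0"
  using init f_decreasing lift_Suc_antimono_le[of "\<lambda>k. f (x k)" 0 k] by simp

lemma accurate_small_successful:
  assumes "accurate k" "\<alpha> k \<le> C"
  shows "successful k"
  unfolding successful_def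
proof (rule accurate_small_step_sufficient_decrease[OF gradient Lipschitz])
  show "norm (g k - grad (x k)) \<le> \<kappa> * \<alpha> k * norm (g k)"
    using assms(1) unfolding accurate_def .
  show "0 < \<alpha> k" using \<alpha>_bounds by simp
  have "(0.5 * L + \<kappa>) * \<alpha> k \<le> (0.5 * L + \<kappa>) * C"
    using assms(2) L \<kappa> by (intro mult_left_mono) auto
  also have "\<dots> = 1 - \<theta>"
    using C L \<kappa> by (simp add: add_eq_0_iff)
  finally show "(0.5 * L + \<kappa>) * \<alpha> k \<le> 1 - \<theta>" .
qed

text \<open>The walk bound with base \<open>inverse \<gamma>\<close>: the start lies
  \<open>c\<close> grid steps above \<open>C\<close> and the cap another \<open>j\<close> steps
  higher. The nonnegative final distance \<open>\<bar>y\<bar>\<close> is dropped.\<close>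

lemma accurate_excess_le_rewards:
  "(\<Sum>k<n. if accurate k then 1 else - 1 :: int) \<le> int c + 2 * (\<Sum>k<n. of_bool (rewarding k))"
proof -
  have C0: "\<alpha>0 = C * inverse \<gamma> powi int c"
    using threshold \<gamma> by (simp add: power_int_def field_simps)
  have max: "\<alpha>max = C * inverse \<gamma> powi int (c + j)"
    unfolding threshold(2) cap[symmetric]
    using \<gamma> by (simp add: power_add power_int_def nat_add_distrib field_simps)
  have "\<exists>y. \<alpha> n = C * inverse \<gamma> powi y \<and> y \<le> int (c + j) \<and>
      \<bar>y\<bar> + (\<Sum>k<n. if accurate k then 1 else - 1)
        \<le> int c + 2 * (\<Sum>k<n. of_bool (accurate k \<and> successful k \<and> C \<le> \<alpha> k))"
    by (rule step_size_walk_bound)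
      (use \<gamma> C_pos C0 max threshold(1) in \<open>auto simp: init success failure one_less_inverse
        intro: accurate_small_successful\<close>)
  then show ?thesis
    unfolding rewarding_def by force
qed

text \<open>If a rewarding step takes the gap from \<open>a\<close> to \<open>b\<close>, then
  \<open>a\<^sup>2 \<le> M * (a - b)\<close> and \<open>b \<le> a\<close> give
  \<open>a * b \<le> M * (a - b)\<close>, that is, \<open>M / a + 1 \<le> M / b\<close>. Other steps
  do not increase the gap, so the estimate telescopes.\<close>

lemma rewards_le_reciprocal_gap:
  assumes "\<And>k. k \<le> n \<Longrightarrow> f xmin < f (x k)"
  shows "(\<Sum>k<n. of_bool (rewarding k)) \<le> M / (f (x n) - f xmin)"
  using assms
proof (induction n)
  case 0
  then show ?case using \<theta> C_pos by (simp add: M_def)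
next
  case (Suc n)
  define a b where "a = f (x n) - f xmin" and "b = f (x (Suc n)) - f xmin"
  have ab: "0 < b" "b \<le> a"
    using Suc.prems[of "Suc n"] f_decreasing[of n] by (simp_all add: a_def b_def)
  have M: "0 \<le> M"
    using \<theta> C_pos by (simp add: M_def)
  have IH: "(\<Sum>k<n. of_bool (rewarding k)) \<le> M / a"
    using Suc by (simp add: a_def)
  have "M / a + of_bool (rewarding n) \<le> M / b"
  proof (cases "rewarding n")
    case False
    then show ?thesis using ab M by (simp add: frac_le)
  next
    case True
    then have "\<theta> * C * a\<^sup>2 \<le> (1 + \<kappa> * \<alpha>max)\<^sup>2 * D\<^sup>2 * (f (x n) - f (x n - \<alpha> n *\<^sub>R g n))"
      using \<alpha>_bounds[of n] C_pos \<kappa> \<theta> unfolding a_def rewarding_def accurate_def successful_def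
      by (intro accurate_large_step_gap_decrease[OF gradient convex] minimizer D f_le_start) auto
    also have "f (x n) - f (x n - \<alpha> n *\<^sub>R g n) = a - b"
      using True by (simp add: a_def b_def success rewarding_def)
    finally have "a\<^sup>2 \<le> M * (a - b)"
      using \<theta> C_pos by (simp add: M_def field_simps)
    moreover have "a * b \<le> a\<^sup>2"
      using ab by (simp add: power2_eq_square)
    ultimately have "a * b \<le> M * (a - b)"
      by linarith
    then show ?thesis
      using True ab by (simp add: field_simps)
  qed
  then show ?case
    using IH by (simp add: b_def)
qed

text \<open>The last iteration is estimated trivially, because the gap after it may be arbitrarily
  small.\<close>

lemma accurate_excess_bound:
  assumes \<epsilon>: "0 < \<epsilon>" and before: "\<And>k. k < n \<Longrightarrow> \<epsilon> < f (x k) - f xmin"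
  shows "(\<Sum>k<n. if accurate k then 1 else - 1 :: real) \<le> c + 2 * (M / \<epsilon>) + 1"
proof -
  have M: "0 \<le> M"
    using \<theta> C_pos by (simp add: M_def)
  show ?thesis
  proof (cases n)
    case 0
    then show ?thesis using M \<epsilon> by simp
  next
    case (Suc n')
    have "(\<Sum>k<n'. of_bool (rewarding k)) \<le> M / (f (x n') - f xmin)"
    proof (rule rewards_le_reciprocal_gap)
      fix k assume "k \<le> n'"
      then show "f xmin < f (x k)" using before[of k] \<epsilon> Suc by simp
    qed
    also have "\<dots> \<le> M / \<epsilon>"
      using before[of n'] M \<epsilon> Suc by (intro divide_left_mono) auto
    finally have "(\<Sum>k<n'. of_bool (rewarding k)) \<le> M / \<epsilon>" .
    moreover have "(\<Sum>k<n'. if accurate k then 1 else - 1 :: real)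
        \<le> c + 2 * (\<Sum>k<n'. of_bool (rewarding k))"
    proof -
      have "real_of_int (\<Sum>k<n'. if accurate k then 1 else - 1)
        \<le> real_of_int (int c + 2 * (\<Sum>k<n'. of_bool (rewarding k)))"
        by (rule of_int_le_iff[THEN iffD2, OF accurate_excess_le_rewards])
      then show ?thesis
        by (simp add: if_distrib cong: if_cong)
    qed
    ultimately show ?thesis
      using Suc by simp
  qed
qed

end

subsection \<open>Biased walks stopped at a random time\<close>

text \<open>The conditional bound is integrated over \<open>A\<close>; since \<open>A\<close>
  belongs to \<open>F\<close>, the conditional expectation may there be replaced by the indicator of
  \<open>E\<close>. It is applied to the event that the process has not yet stopped.\<close>

lemma (in prob_space) prob_Int_ge_real_cond_exp:
  assumes sub: "subalgebra M F" and A: "A \<in> sets F" and E: "E \<in> events"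
    and ge: "AE \<omega> in M. p \<le> real_cond_exp M F (indicator E) \<omega>"
  shows "p * prob A \<le> prob (E \<inter> A)"
proof -
  interpret finite_measure_subalgebra M F
    by unfold_locales (rule sub)
  have A': "A \<in> events"
    using A sub by (auto simp: subalgebra_def)
  have int: "integrable M (\<lambda>\<omega>. indicator A \<omega> * indicator E \<omega> :: real)"
    using A' E by (simp add: integrable_real_indicator emeasure_eq_measure flip: indicator_inter_arith)
  have "p * prob A = (\<integral>\<omega>. indicator A \<omega> * p \<partial>M)"
    using A' by simp
  also have "\<dots> \<le> (\<integral>\<omega>. indicator A \<omega> * real_cond_exp M F (indicator E) \<omega> \<partial>M)"
  proof (rule integral_mono_AE)
    show "integrable M (\<lambda>\<omega>. indicator A \<omega> * real_cond_exp M F (indicator E) \<omega>)"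
      using A E int by (intro real_cond_exp_intg(1)) auto
    show "AE \<omega> in M. indicator A \<omega> * p \<le> indicator A \<omega> * real_cond_exp M F (indicator E) \<omega>"
      using ge by eventually_elim (simp add: mult_left_mono)
  qed (use A' in \<open>simp add: integrable_real_indicator emeasure_eq_measure\<close>)
  also have "\<dots> = (\<integral>\<omega>. indicator A \<omega> * indicator E \<omega> \<partial>M)"
    using A E int by (intro real_cond_exp_intg(2)) auto
  also have "\<dots> = prob (E \<inter> A)"
    using A' E by (simp add: Int_commute flip: indicator_inter_arith)
  finally show ?thesis .
qed

text \<open>The compensated walk \<open>(\<Sum>k<n. 2 * indicator (E k) - 1) - (2 * p - 1) * n\<close> is a
  submartingale, and \<open>N\<close> is a stopping time.\<close>

lemma (in prob_space) expected_stopping_time_le: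
  fixes N :: "'a \<Rightarrow> enat"
  assumes sub: "\<And>k. subalgebra M (F k)"
    and stop: "\<And>k. {\<omega> \<in> space M. enat k < N \<omega>} \<in> sets (F k)"
    and E: "\<And>k. E k \<in> events"
    and ge: "\<And>k. AE \<omega> in M. p \<le> real_cond_exp M (F k) (indicator (E k)) \<omega>"
    and p: "1 / 2 < p"
    and excess: "\<And>\<omega> n. \<omega> \<in> space M \<Longrightarrow> enat n \<le> N \<omega> \<Longrightarrow>
      (\<Sum>k<n. if \<omega> \<in> E k then 1 else - 1) \<le> B"
  shows "(\<integral>\<^sup>+ \<omega>. ennreal_of_enat (N \<omega>) \<partial>M) \<le> ennreal (B / (2 * p - 1))"
proof -
  define A where "A k = {\<omega> \<in> space M. enat k < N \<omega>}" for k
  have A: "A k \<in> events" for k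
    using stop[of k] sub[of k] by (auto simp: A_def subalgebra_def)
  \<comment> \<open>A finite horizon keeps all integrals finite; the bound does not depend on
    \<open>n\<close> and so passes to the limit.\<close>
  have sum_le: "(\<Sum>k<n. prob (A k)) \<le> B / (2 * p - 1)" for n
  proof -
    \<comment> \<open>The integrand is the \<open>k\<close>-th increment of the walk stopped at
      \<open>N\<close>.\<close>
    have step: "(\<integral>\<omega>. indicator (A k) \<omega> * (2 * indicator (E k) \<omega> - 1) \<partial>M)
        = 2 * prob (E k \<inter> A k) - prob (A k)" for k
    proof -
      have "(\<integral>\<omega>. indicator (A k) \<omega> * (2 * indicator (E k) \<omega> - 1) \<partial>M)
        = (\<integral>\<omega>. 2 * indicator (E k \<inter> A k) \<omega> - indicator (A k) \<omega> \<partial>M :: real)"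
        by (intro Bochner_Integration.integral_cong) (auto split: split_indicator)
      also have "\<dots> = 2 * prob (E k \<inter> A k) - prob (A k)"
        using A[of k] E[of k] by (simp add: integrable_real_indicator emeasure_eq_measure)
      finally show ?thesis .
    qed
    have int: "integrable M (\<lambda>\<omega>. indicator (A k) \<omega> * (2 * indicator (E k) \<omega> - 1) :: real)" for k
      using A[of k] E[of k] by (intro integrable_real_mult_indicator integrable_const_bound[of _ 1] AE_I2)
        (auto split: split_indicator)
    have "(2 * p - 1) * prob (A k) \<le> 2 * prob (E k \<inter> A k) - prob (A k)" for k
      using prob_Int_ge_real_cond_exp[OF sub stop E ge, of k] by (simp add: A_def algebra_simps)
    then have "(2 * p - 1) * (\<Sum>k<n. prob (A k)) \<le> (\<Sum>k<n. 2 * prob (E k \<inter> A k) - prob (A k))"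
      unfolding sum_distrib_left by (intro sum_mono)
    also have "\<dots> = (\<integral>\<omega>. (\<Sum>k<n. indicator (A k) \<omega> * (2 * indicator (E k) \<omega> - 1)) \<partial>M)"
      using int by (subst Bochner_Integration.integral_sum) (simp_all only: step)
    also have "\<dots> \<le> (\<integral>\<omega>. B \<partial>M)"
    proof (rule integral_mono)
      fix \<omega> assume \<omega>: "\<omega> \<in> space M"
      \<comment> \<open>This is the minimum of \<open>N \<omega>\<close> and \<open>n\<close>. The
        stopped sum runs over an initial segment of length \<open>m\<close>, to which the pathwise
        bound \<open>excess\<close> applies.\<close>
      define m where "m = (case N \<omega> of enat i \<Rightarrow> min i n | \<infinity> \<Rightarrow> n)"
      have m: "enat m \<le> N \<omega>" "{k. k < n \<and> \<omega> \<in> A k} = {..<m}"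
        using \<omega> by (auto simp: m_def A_def split: enat.splits)
      have "(\<Sum>k<n. indicator (A k) \<omega> * (2 * indicator (E k) \<omega> - 1))
        = (\<Sum>k | k < n \<and> \<omega> \<in> A k. if \<omega> \<in> E k then 1 else - 1 :: real)"
        by (intro sum.mono_neutral_cong_right) (auto split: split_indicator)
      also have "\<dots> \<le> B"
        unfolding m(2) by (rule excess[OF \<omega> m(1)])
      finally show "(\<Sum>k<n. indicator (A k) \<omega> * (2 * indicator (E k) \<omega> - 1)) \<le> B" .
    qed (rule Bochner_Integration.integrable_sum, rule int, simp)
    finally show ?thesis
      using p by (simp add: pos_le_divide_eq mult.commute prob_space)
  qed
  \<comment> \<open>As \<open>enat\<close> is countable, singletons suffice, and each is obtained
    from the events that \<open>N\<close> exceeds a given \<open>k\<close>.\<close>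
  have "N \<in> measurable M (count_space UNIV)"
    unfolding measurable_count_space_eq2_countable
  proof (intro conjI ballI)
    fix e :: enat
    have sets: "{\<omega> \<in> space M. enat k < N \<omega>} \<in> events" for k
      using A[of k] by (simp add: A_def)
    have "{\<omega> \<in> space M. N \<omega> = e} \<in> events"
    proof (cases e)
      case infinity
      have "{\<omega> \<in> space M. N \<omega> = e} = (\<Inter>k. {\<omega> \<in> space M. enat k < N \<omega>})"
        using infinity by (auto, metis enat_ord_simps(4) less_irrefl not_infinity_eq)
      then show ?thesis using sets by auto
    next
      case (enat i)
      \<comment> \<open>The intersection with \<open>space M\<close> matters for
        \<open>i = 0\<close>, where the indexed intersection is the whole type.\<close>
      have "{\<omega> \<in> space M. N \<omega> = e}
        = (\<Inter>k\<in>{..<i}. {\<omega> \<in> space M. enat k < N \<omega>}) \<inter> space M - {\<omega> \<in> space M. enat i < N \<omega>}"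
        (is "?l = ?r")
      proof (intro set_eqI iffI)
        fix \<omega> assume "\<omega> \<in> ?l" then show "\<omega> \<in> ?r" using enat by auto
      next
        fix \<omega> assume *: "\<omega> \<in> ?r"
        then obtain l where l: "N \<omega> = enat l" "l \<le> i" by (cases "N \<omega>") auto
        then have "\<not> l < i" using * by auto
        then show "\<omega> \<in> ?l" using * l enat by auto
      qed
      moreover have "(\<Inter>k\<in>{..<i}. {\<omega> \<in> space M. enat k < N \<omega>}) \<inter> space M \<in> events"
        using sets by (cases "i = 0") auto
      ultimately show ?thesis using sets by auto
    qed
    then show "N -` {e} \<inter> space M \<in> events"
      by (simp add: vimage_def Int_def conj_commute)
  qed simp
  \<comment> \<open>Tail-sum formula for the expectation; finiteness of \<open>N\<close> is not
    presupposed.\<close>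
  then have "(\<integral>\<^sup>+ \<omega>. ennreal_of_enat (N \<omega>) \<partial>M) = (\<Sum>k. ennreal (prob (A k)))"
    by (simp add: nn_integral_enat_function A_def emeasure_eq_measure)
  also have "\<dots> \<le> ennreal (B / (2 * p - 1))"
  proof (rule suminf_le_const)
    fix n
    show "(\<Sum>k<n. ennreal (prob (A k))) \<le> ennreal (B / (2 * p - 1))"
      using sum_le[of n] by (simp add: ennreal_leI)
  qed simp
  finally show ?thesis .
qed

subsection \<open>Measurability with respect to the past models\<close>

text \<open>The state at time \<open>k\<close> is a measurable function of the directions before
  \<open>k\<close>. The measure \<open>N\<close> is arbitrary so that the lemma serves both for
  \<open>P\<close> and for the past of the models.\<close>

lemma line_search_run_measurable:
  fixes X G :: "nat \<Rightarrow> 'w \<Rightarrow> 'a::euclidean_space" and A :: "nat \<Rightarrow> 'w \<Rightarrow> real"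
  assumes f [measurable]: "f \<in> borel_measurable borel"
    and run: "\<And>\<omega>. \<omega> \<in> space N \<Longrightarrow>
      line_search_run f \<theta> \<gamma> \<alpha>max x0 \<alpha>0 (\<lambda>k. X k \<omega>) (\<lambda>k. A k \<omega>) (\<lambda>k. G k \<omega>)"
    and G: "\<And>i. i < k \<Longrightarrow> G i \<in> borel_measurable N"
  shows "X k \<in> borel_measurable N \<and> A k \<in> borel_measurable N"
  using G
proof (induction k)
  case 0
  have "X 0 \<in> borel_measurable N \<longleftrightarrow> (\<lambda>_. x0) \<in> borel_measurable N"
    by (rule measurable_cong) (use run in \<open>simp add: line_search_run_def\<close>)
  moreover have "A 0 \<in> borel_measurable N \<longleftrightarrow> (\<lambda>_. \<alpha>0) \<in> borel_measurable N"
    by (rule measurable_cong) (use run in \<open>simp add: line_search_run_def\<close>)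
  ultimately show ?case by simp
next
  case (Suc k)
  have [measurable]: "X k \<in> borel_measurable N" "A k \<in> borel_measurable N" "G k \<in> borel_measurable N"
    using Suc by auto
  have [measurable]: "Measurable.pred N (\<lambda>\<omega>. sufficient_decrease f \<theta> (X k \<omega>) (A k \<omega>) (G k \<omega>))"
    unfolding sufficient_decrease_def by measurable
  have "X (Suc k) \<in> borel_measurable N \<longleftrightarrow>
    (\<lambda>\<omega>. if sufficient_decrease f \<theta> (X k \<omega>) (A k \<omega>) (G k \<omega>)
      then X k \<omega> - A k \<omega> *\<^sub>R G k \<omega> else X k \<omega>) \<in> borel_measurable N"
    by (rule measurable_cong) (use run in \<open>auto simp: line_search_run_def\<close>)
  moreover have "A (Suc k) \<in> borel_measurable N \<longleftrightarrow>
    (\<lambda>\<omega>. if sufficient_decrease f \<theta> (X k \<omega>) (A k \<omega>) (G k \<omega>)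
      then min \<alpha>max (inverse \<gamma> * A k \<omega>) else \<gamma> * A k \<omega>) \<in> borel_measurable N"
    by (rule measurable_cong) (use run in \<open>auto simp: line_search_run_def\<close>)
  ultimately show ?case by simp
qed

lemma space_past_models [simp]: "space (past_models P M k) = space P"
  by (simp add: past_models_def space_measure_of_conv)

lemma sets_past_models:
  "sets (past_models P M k) =
    sigma_sets (space P) {(\<lambda>\<omega>. M i \<omega> x) -` B \<inter> space P |i x B. i < k \<and> B \<in> sets borel}"
  unfolding past_models_def by (rule sets_measure_of) auto

lemma subalgebra_past_models:
  assumes "\<And>i x. i < k \<Longrightarrow> (\<lambda>\<omega>. M i \<omega> x) \<in> borel_measurable P"
  shows "subalgebra P (past_models P M k)"
  unfolding subalgebra_def sets_past_models
  using assms by (auto intro!: sets.sigma_sets_subset measurable_sets)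

lemma measurable_past_models:
  assumes "i < k"
  shows "(\<lambda>\<omega>. M i \<omega> x) \<in> borel_measurable (past_models P M k)"
  by (rule measurableI) (use assms in \<open>auto simp: sets_past_models\<close>)

text \<open>The direction is recovered from the linear model as a difference of two of its values.\<close>

lemma direction_measurable_past_models:
  fixes X G :: "nat \<Rightarrow> 'w \<Rightarrow> 'a::euclidean_space"
  assumes "i < k"
  shows "G i \<in> borel_measurable (past_models P (\<lambda>i \<omega>. linear_model f (X i \<omega>) (G i \<omega>)) k)"
    (is "_ \<in> borel_measurable ?F")
proof (subst borel_measurable_euclidean_space, rule ballI)
  fix e :: 'a assume "e \<in> Basis"
  have "G i \<omega> \<bullet> e = linear_model f (X i \<omega>) (G i \<omega>) e - linear_model f (X i \<omega>) (G i \<omega>) 0" for \<omega>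
    by (simp add: linear_model_def inner_diff_left inner_diff_right inner_commute[of e])
  moreover have "(\<lambda>\<omega>. linear_model f (X i \<omega>) (G i \<omega>) e - linear_model f (X i \<omega>) (G i \<omega>) 0)
      \<in> borel_measurable ?F"
    by (intro borel_measurable_diff
        measurable_past_models[OF assms, where M = "\<lambda>i \<omega>. linear_model f (X i \<omega>) (G i \<omega>)"])
  ultimately show "(\<lambda>\<omega>. G i \<omega> \<bullet> e) \<in> borel_measurable ?F"
    by simp
qed

text \<open>Only iterates up to \<open>n\<close> are involved, which makes the hitting time a
  stopping time. Passing to \<open>Suc n\<close> expresses the event as a lower bound on the
  infimum, so an infinite hitting time needs no separate case.\<close>

lemma less_iterations_until_iff:
  "enat n < iterations_until f fmin \<epsilon> x \<longleftrightarrow> (\<forall>k\<le>n. \<epsilon> < f (x k) - fmin)"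
proof -
  have "enat (Suc n) \<le> iterations_until f fmin \<epsilon> x \<longleftrightarrow> (\<forall>k\<le>n. \<epsilon> < f (x k) - fmin)"
    unfolding iterations_until_def le_INF_iff by (auto simp: not_less_eq_eq not_le Suc_le_eq)
  then show ?thesis
    by (simp add: Suc_ile_eq)
qed

section \<open>The bound on the expected hitting time\<close>

theorem theorem3p2:
  fixes P :: "'w measure"
    and f :: "real ^ 'n \<Rightarrow> real" and grad :: "real ^ 'n \<Rightarrow> real ^ 'n"
    and X G :: "nat \<Rightarrow> 'w \<Rightarrow> real ^ 'n" and A :: "nat \<Rightarrow> 'w \<Rightarrow> real"
    and x0 xmin :: "real ^ 'n"
    and L D \<gamma> \<theta> \<alpha>max \<alpha>0 \<kappa> p \<epsilon> :: real and c j :: nat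
  assumes "prob_space P"
    and gradient: "\<And>x. GDERIV f x :> grad x"
    and C1: "continuous_on UNIV grad"
    and below: "bdd_below (range f)"
    and L: "0 < L"
    and Lipschitz: "\<And>x y. norm (grad x - grad y) \<le> L * norm (x - y)"
    and convex: "convex_on UNIV f"
    and level_sets: "\<And>b. bounded {x. f x \<le> b}"
    and minimizer: "\<And>x. f xmin \<le> f x"
    and D: "\<And>x. f x \<le> f x0 \<Longrightarrow> norm (x - xmin) \<le> D"
    and \<gamma>: "0 < \<gamma>" "\<gamma> < 1"
    and \<theta>: "0 < \<theta>" "\<theta> < 1"
    and \<alpha>: "0 < \<alpha>0" "\<alpha>0 < \<alpha>max"
    and directions: "\<And>k. G k \<in> borel_measurable P"
    and algorithm: "\<And>\<omega>. \<omega> \<in> space P \<Longrightarrow>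
      line_search_run f \<theta> \<gamma> \<alpha>max x0 \<alpha>0 (\<lambda>k. X k \<omega>) (\<lambda>k. A k \<omega>) (\<lambda>k. G k \<omega>)"
    and \<kappa>: "0 < \<kappa>"
    and p: "1 / 2 < p"
    and accurate: "prob_sufficiently_accurate P f grad p \<kappa> X A G"
    and threshold: "0 < c" "(1 - \<theta>) / (0.5 * L + \<kappa>) = \<gamma> ^ c * \<alpha>0" "\<gamma> ^ c * \<alpha>0 < \<gamma> * \<alpha>max"
    \<comment> \<open>the cap is itself on the grid of step sizes; without this the bound can fail\<close>
    and cap: "\<gamma> ^ j * \<alpha>max = \<alpha>0"
    and \<epsilon>: "0 < \<epsilon>"
  shows "(\<integral>\<^sup>+ \<omega>. ennreal_of_enat (iterations_until f (f xmin) \<epsilon> (\<lambda>k. X k \<omega>)) \<partial>P)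
    \<le> ennreal (2 * p / (2 * p - 1)\<^sup>2 *
        ((1 + \<kappa> * \<alpha>max)\<^sup>2 * D\<^sup>2 * (0.5 * L + \<kappa>) / (\<theta> * (1 - \<theta>)) / \<epsilon>
          + log \<gamma> ((1 - \<theta>) / (\<alpha>0 * (0.5 * L + \<kappa>)))))"
proof -
  interpret prob_space P by fact
  define F where "F = past_models P (\<lambda>i \<omega>. linear_model f (X i \<omega>) (G i \<omega>))"
  define E where "E = accurate_event P grad \<kappa> X A G"
  define N where "N \<omega> = iterations_until f (f xmin) \<epsilon> (\<lambda>k. X k \<omega>)" for \<omega>
  define C where "C = (1 - \<theta>) / (0.5 * L + \<kappa>)"
  define M where "M = (1 + \<kappa> * \<alpha>max)\<^sup>2 * D\<^sup>2 / (\<theta> * C)"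
  have path: "line_search_path f grad x0 xmin L D \<gamma> \<theta> \<alpha>max \<alpha>0 \<kappa> C c j
      (\<lambda>k. X k \<omega>) (\<lambda>k. G k \<omega>) (\<lambda>k. A k \<omega>)" if "\<omega> \<in> space P" for \<omega>
    by unfold_locales
      (use gradient L Lipschitz convex minimizer D \<gamma> \<theta> \<kappa> threshold cap algorithm that
        in \<open>auto simp: C_def\<close>)
  have f [measurable]: "f \<in> borel_measurable borel"
    by (rule borel_measurable_continuous_onI) (rule GDERIV_imp_continuous_on[OF gradient])
  have [measurable]: "grad \<in> borel_measurable borel"
    by (intro borel_measurable_continuous_onI C1)
  have [measurable]: "X k \<in> borel_measurable P" "A k \<in> borel_measurable P" for k
    using line_search_run_measurable[OF f algorithm directions] by auto
  note [measurable] = directions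
  have sub: "subalgebra P (F k)" for k
    unfolding F_def linear_model_def by (rule subalgebra_past_models) measurable
  have space_F: "space (F k) = space P" for k
    by (simp add: F_def)
  \<comment> \<open>The index \<open>i = k\<close> is included: \<open>F k\<close> knows the models
    before \<open>k\<close>, and these already determine the \<open>k\<close>-th iterate.\<close>
  have X_F: "X i \<in> borel_measurable (F k)" if "i \<le> k" for i k
  proof -
    have "G l \<in> borel_measurable (F k)" if "l < i" for l
      unfolding F_def using that \<open>i \<le> k\<close> by (intro direction_measurable_past_models) simp
    then have "X i \<in> borel_measurable (F k) \<and> A i \<in> borel_measurable (F k)"
      by (intro line_search_run_measurable[OF f algorithm]) (simp_all add: F_def)
    then show ?thesis ..
  qed
  have stop: "{\<omega> \<in> space P. enat k < N \<omega>} \<in> sets (F k)" for k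
  proof -
    have "{\<omega> \<in> space (F k). \<forall>i\<in>{..k}. \<epsilon> < f (X i \<omega>) - f xmin} \<in> sets (F k)"
      using X_F by (intro sets.sets_Collect_finite_All') auto
    then show ?thesis
      unfolding space_F N_def less_iterations_until_iff Ball_def atMost_iff .
  qed
  have E_sets: "E k \<in> events" for k
    unfolding E_def accurate_event_def by measurable
  have ge: "AE \<omega> in P. p \<le> real_cond_exp P (F k) (indicator (E k)) \<omega>" for k
    using accurate unfolding prob_sufficiently_accurate_def F_def E_def by blast
  \<comment> \<open>The accuracy condition for \<open>k = 0\<close>, integrated over the whole
    space, bounds \<open>p\<close> by a probability.\<close>
  have p_le_1: "p \<le> 1"
  proof -
    have "space P \<in> sets (F 0)"
      using sets.top[of "F 0"] unfolding space_F .
    from prob_Int_ge_real_cond_exp[OF sub this E_sets ge]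
    have "p * prob (space P) \<le> prob (E 0 \<inter> space P)" .
    also have "\<dots> \<le> 1"
      by (rule prob_le_1)
    finally show ?thesis
      by (simp add: prob_space)
  qed
  have excess: "(\<Sum>k<n. if \<omega> \<in> E k then 1 else - 1) \<le> c + 2 * (M / \<epsilon>) + 1"
    if \<omega>: "\<omega> \<in> space P" and n: "enat n \<le> N \<omega>" for \<omega> n
  proof -
    interpret path: line_search_path f grad x0 xmin L D \<gamma> \<theta> \<alpha>max \<alpha>0 \<kappa> C c j
      "\<lambda>k. X k \<omega>" "\<lambda>k. G k \<omega>" "\<lambda>k. A k \<omega>"
      by (rule path[OF \<omega>])
    have "\<epsilon> < f (X k \<omega>) - f xmin" if "k < n" for k
    proof -
      have "enat k < N \<omega>"
        using that n by (meson enat_ord_simps(2) order_less_le_trans)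
      then show ?thesis
        unfolding N_def less_iterations_until_iff by blast
    qed
    from path.accurate_excess_bound[OF \<epsilon> this] show ?thesis
      using \<omega> by (simp add: E_def accurate_event_def path.accurate_def path.M_def M_def)
  qed
  have "(\<integral>\<^sup>+ \<omega>. ennreal_of_enat (N \<omega>) \<partial>P) \<le> ennreal ((c + 2 * (M / \<epsilon>) + 1) / (2 * p - 1))"
    by (rule expected_stopping_time_le[OF sub stop E_sets ge p excess])
  also have "\<dots> \<le> ennreal (2 * p / (2 * p - 1)\<^sup>2 * (M / \<epsilon> + c))"
  proof (rule ennreal_leI)
    have C: "0 < C" using L \<kappa> \<theta> by (simp add: C_def)
    have M: "0 \<le> M / \<epsilon>"
      using \<epsilon> C \<theta> by (simp add: M_def)
    \<comment> \<open>Here \<open>1 \<le> c\<close> absorbs the 1 contributed by the last iteration.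
      The factor \<open>p / (2 * p - 1)\<close> introduced next is slack that leads to the stated
      form.\<close>
    have "c + 2 * (M / \<epsilon>) + 1 \<le> 2 * (M / \<epsilon> + c)"
      using threshold(1) by simp
    also have "\<dots> \<le> p / (2 * p - 1) * (2 * (M / \<epsilon> + c))"
    proof -
      have "1 \<le> p / (2 * p - 1)"
        using p p_le_1 by (simp add: field_simps)
      then show ?thesis
        using mult_right_mono[of 1 "p / (2 * p - 1)" "2 * (M / \<epsilon> + c)"] M by simp
    qed
    finally have "(c + 2 * (M / \<epsilon>) + 1) / (2 * p - 1)
        \<le> p / (2 * p - 1) * (2 * (M / \<epsilon> + c)) / (2 * p - 1)"
      using p by (intro divide_right_mono) auto
    then show "(c + 2 * (M / \<epsilon>) + 1) / (2 * p - 1) \<le> 2 * p / (2 * p - 1)\<^sup>2 * (M / \<epsilon> + c)"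
      by (simp add: power2_eq_square mult_ac)
  qed
  also have "M = (1 + \<kappa> * \<alpha>max)\<^sup>2 * D\<^sup>2 * (0.5 * L + \<kappa>) / (\<theta> * (1 - \<theta>))"
    by (simp add: M_def C_def)
  \<comment> \<open>The threshold divided by \<open>\<alpha>0\<close> is exactly
    \<open>\<gamma> ^ c\<close>.\<close>
  also have "real c = log \<gamma> ((1 - \<theta>) / (\<alpha>0 * (0.5 * L + \<kappa>)))"
  proof -
    have "(1 - \<theta>) / (\<alpha>0 * (0.5 * L + \<kappa>)) = (1 - \<theta>) / (0.5 * L + \<kappa>) / \<alpha>0"
      by simp
    also have "\<dots> = \<gamma> ^ c"
      unfolding threshold(2) using \<alpha> by simp
    finally show ?thesis
      using \<gamma> by (simp add: log_nat_power)
  qed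
  finally show ?thesis
    unfolding N_def .
qed

end
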